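(* Let $R$ be a Noetherian local ring, $d=\dim R$, and let $x_1,\ldots,x_d$ be a system of parameters of $R$. Let $y_1,\ldots,y_d$ be a sequence of elements of $R$ such that $(y_1,\ldots,y_d)\subset (x_1,\ldots,x_d)$. If $y_1,\ldots,y_d$ is a system of parameters of $R$, then the natural map $\Phi: H^d_{(x_1,\ldots,x_d)}(R)\to H^d_{(y_1,\ldots,y_d)}(R)$ is injective.
   Context: For a sequence $\underline{x}=x_1,\ldots,x_d$ and a positive integer $n$, write $(\underline{x})^{[n]}=(x_1^n,\ldots,x_d^n)$. The top local cohomology $H^d_{(\underline{x})}(R)$ is identified with $\varinjlim_n R/(\underline{x})^{[n]}$ (transition maps are multiplication by $x_1\cdots x_d$); equivalently with $R_{x_1\cdots x_d}/\sum_i \mathrm{im}(R_{x_1\cdots \widehat{x_i}\cdots x_d})$. The class of $r\in R/(\underline{x})^{[n]}$ is denoted $\left[\frac{r}{x_1^n\cdots x_d^n}\right]$. The map $\Phi$: given $u=\left[\frac{r}{x_1^n\cdots x_d^n}\right]\in H^d_{(\underline{x})}(R)$, since $(\underline{y})\subset(\underline{x})$ there exist a positive integer $s$ and a $d\times d$ matrix $B=(b_{ij})$ over $R$ with $y_i^s=\sum_{j} b_{ij}x_j^n$ for all $i$. Then $\Phi(u)=\left[\frac{r\det B}{y_1^s\cdots y_d^s}\right]\in H^d_{(\underline{y})}(R)$. This is a well-defined $R$-module homomorphism, independent of the choices. *)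

theory Defs
  imports
    "Jordan_Normal_Form.Determinant"
    "Jordan_Normal_Form.VS_Connect"
    "HOL-Algebra.QuotRing"
    "HOL-Algebra.Ring_Divisibility"
    "HOL-Library.Extended_Nat"
begin

section \<open>Local rings, dimension, systems of parameters\<close>

definition local_ring :: "('a, 'b) ring_scheme \<Rightarrow> bool" where
  "local_ring R \<longleftrightarrow> cring R \<and> (\<exists>!M. maximalideal M R)"

definition max_ideal :: "('a, 'b) ring_scheme \<Rightarrow> 'a set" where
  "max_ideal R = (THE M. maximalideal M R)"

definition krull_dim :: "('a, 'b) ring_scheme \<Rightarrow> enat" where
  "krull_dim R = Sup {enat n | n. \<exists>P :: nat \<Rightarrow> 'a set.
     (\<forall>i\<le>n. primeideal (P i) R) \<and> (\<forall>i<n. P i \<subset> P (Suc i))}"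

definition ideal_radical :: "('a, 'b) ring_scheme \<Rightarrow> 'a set \<Rightarrow> 'a set" where
  "ideal_radical R I = {a \<in> carrier R. \<exists>k::nat. a [^]\<^bsub>R\<^esub> k \<in> I}"

definition system_of_parameters :: "('a, 'b) ring_scheme \<Rightarrow> 'a vec \<Rightarrow> bool" where
  "system_of_parameters R x \<longleftrightarrow>
     set\<^sub>v x \<subseteq> carrier R \<and> enat (dim_vec x) = krull_dim R \<and>
     ideal_radical R (Idl\<^bsub>R\<^esub> (set\<^sub>v x)) = max_ideal R"


section \<open>Direct limits of modules\<close>

text \<open>
  A direct system over the index set \<open>I\<close> consists of modules \<open>M i\<close> and transition maps
  \<open>f i j\<close> from \<open>M i\<close> to \<open>M j\<close> for \<open>i \<le> j\<close>. The direct limit is the quotient of the disjoint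
  union of the \<open>M i\<close> by eventual equality. The operations are unions of classes over all
  representatives; for a direct system all the classes in such a union coincide.
\<close>

definition dirlim_rel ::
    "'i::order set \<Rightarrow> ('i \<Rightarrow> ('r, 'm) module) \<Rightarrow> ('i \<Rightarrow> 'i \<Rightarrow> 'm \<Rightarrow> 'm) \<Rightarrow> (('i \<times> 'm) \<times> ('i \<times> 'm)) set"
  where
  "dirlim_rel I M f = {((i, a), (j, b)). i \<in> I \<and> j \<in> I \<and> a \<in> carrier (M i) \<and> b \<in> carrier (M j) \<and>
     (\<exists>k\<in>I. i \<le> k \<and> j \<le> k \<and> f i k a = f j k b)}"

definition dirlim_class ::
    "'i::order set \<Rightarrow> ('i \<Rightarrow> ('r, 'm) module) \<Rightarrow> ('i \<Rightarrow> 'i \<Rightarrow> 'm \<Rightarrow> 'm) \<Rightarrow> 'i \<Rightarrow> 'm \<Rightarrow> ('i \<times> 'm) set"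
  where
  "dirlim_class I M f i a = dirlim_rel I M f `` {(i, a)}"

text \<open>The ring fields \<open>mult\<close> and \<open>one\<close> of the record carry no meaning for a module.\<close>

definition direct_limit ::
    "'i::order set \<Rightarrow> ('i \<Rightarrow> ('r, 'm) module) \<Rightarrow> ('i \<Rightarrow> 'i \<Rightarrow> 'm \<Rightarrow> 'm) \<Rightarrow> ('r, ('i \<times> 'm) set) module"
  where
  "direct_limit I M f =
    \<lparr>carrier = (SIGMA i:I. carrier (M i)) // dirlim_rel I M f,
     monoid.mult = undefined,
     one = undefined,
     zero = (\<Union>i\<in>I. dirlim_class I M f i \<zero>\<^bsub>M i\<^esub>),
     add = (\<lambda>X Y. \<Union>(i, a)\<in>X. \<Union>(j, b)\<in>Y. \<Union>k\<in>{k\<in>I. i \<le> k \<and> j \<le> k}.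
              dirlim_class I M f k (f i k a \<oplus>\<^bsub>M k\<^esub> f j k b)),
     smult = (\<lambda>r X. \<Union>(i, a)\<in>X. dirlim_class I M f i (r \<odot>\<^bsub>M i\<^esub> a))\<rparr>"


section \<open>Top local cohomology\<close>

definition quot_module :: "'a ring \<Rightarrow> 'a set \<Rightarrow> ('a, 'a set) module" where
  "quot_module R I =
     ring.extend (R Quot I) (module.fields (\<lambda>r X. (I +>\<^bsub>R\<^esub> r) \<otimes>\<^bsub>R Quot I\<^esub> X))"

text \<open>Multiplication by \<open>a\<close> as a map from \<open>R/I\<close> to \<open>R/J\<close>, meaningful when \<open>a I \<subseteq> J\<close>.\<close>

definition quot_mult :: "'a ring \<Rightarrow> 'a set \<Rightarrow> 'a \<Rightarrow> 'a set \<Rightarrow> 'a set" where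
  "quot_mult R J a X = (\<Union>r\<in>X. J +>\<^bsub>R\<^esub> (a \<otimes>\<^bsub>R\<^esub> r))"

text \<open>
  From here on the ring is a type \<open>'a\<close> of class \<^class>\<open>comm_ring_1\<close>, viewed as the structure
  \<^term>\<open>class_ring :: 'a::comm_ring_1 ring\<close> where ideals and quotients are concerned; a sequence
  of length \<open>d\<close> is a vector of dimension \<open>d\<close>.
\<close>

definition vec_pow :: "'a::comm_ring_1 vec \<Rightarrow> nat \<Rightarrow> 'a vec" where
  "vec_pow x n = map_vec (\<lambda>a. a ^ n) x"

definition pow_ideal :: "'a::comm_ring_1 vec \<Rightarrow> nat \<Rightarrow> 'a set" where
  "pow_ideal x n = Idl\<^bsub>class_ring\<^esub> (set\<^sub>v (vec_pow x n))"

definition lc_module :: "'a::comm_ring_1 vec \<Rightarrow> nat \<Rightarrow> ('a, 'a set) module" where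
  "lc_module x n = quot_module class_ring (pow_ideal x n)"

text \<open>The transition map from level \<open>n\<close> to level \<open>m\<close> is the \<open>(m - n)\<close>-fold composite of the
  multiplication by \<open>x\<^sub>1 \<cdots> x\<^sub>d\<close>.\<close>

definition lc_trans :: "'a::comm_ring_1 vec \<Rightarrow> nat \<Rightarrow> nat \<Rightarrow> 'a set \<Rightarrow> 'a set" where
  "lc_trans x n m = quot_mult class_ring (pow_ideal x m) ((\<Prod>i<dim_vec x. x $ i) ^ (m - n))"

definition top_local_cohomology :: "'a::comm_ring_1 vec \<Rightarrow> ('a, (nat \<times> 'a set) set) module" where
  "top_local_cohomology x = direct_limit {0<..} (lc_module x) (lc_trans x)"

text \<open>The class of \<open>r / (x\<^sub>1\<^sup>n \<cdots> x\<^sub>d\<^sup>n)\<close>.\<close>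

definition lc_class :: "'a::comm_ring_1 vec \<Rightarrow> 'a \<Rightarrow> nat \<Rightarrow> (nat \<times> 'a set) set" where
  "lc_class x r n =
     dirlim_class {0<..} (lc_module x) (lc_trans x) n (pow_ideal x n +>\<^bsub>class_ring\<^esub> r)"

text \<open>
  The natural map for \<open>(y) \<subseteq> (x)\<close>. The value does not depend on the representative \<open>(r, n)\<close>,
  nor on \<open>s\<close> and \<open>B\<close>, whence the definite description.
\<close>

definition lc_map ::
    "'a::comm_ring_1 vec \<Rightarrow> 'a vec \<Rightarrow> (nat \<times> 'a set) set \<Rightarrow> (nat \<times> 'a set) set" where
  "lc_map x y u = (THE v. \<exists>r n s B. 0 < n \<and> 0 < s \<and> B \<in> carrier_mat (dim_vec y) (dim_vec x) \<and>
     u = lc_class x r n \<and> vec_pow y s = B *\<^sub>v vec_pow x n \<and> v = lc_class y (r * det B) s)"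

end

theory Submission
  imports Defs
begin

text \<open>
  The natural map is injective because it has a left inverse, which is again a natural map. Two
  systems of parameters \<open>x\<close> and \<open>y\<close> generate ideals with the same radical, the maximal ideal. So
  powers of the \<open>x\<^sub>i\<close> lie in every ideal \<open>(y\<^sub>1\<^sup>s, \<dots>, y\<^sub>d\<^sup>s)\<close>, and the recipe that sends the class of
  \<open>r / (x\<^sub>1\<^sup>n \<cdots> x\<^sub>d\<^sup>n)\<close> to that of \<open>r det B / (y\<^sub>1\<^sup>s \<cdots> y\<^sub>d\<^sup>s)\<close> can also be followed from \<open>y\<close> to \<open>x\<close>,
  with a matrix \<open>C\<close>. Composing the two maps multiplies \<open>r\<close> by \<open>det C det B = det (C B)\<close>, and
  \<open>C B\<close> maps powers of \<open>x\<close> to powers of \<open>x\<close>, just as an identity matrix does. Hence the composite is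
  the identity, provided that the recipe does not depend on the matrix
  (\<open>lc_eq_det\<close>, \<open>lc_map_lc_map\<close>).

  This independence rests on the determinantal fact \<open>prod_mult_det_diff\<close>: if \<open>A x = B x = y\<close>,
  then \<open>y\<^sub>1 \<cdots> y\<^sub>d (det A - det B)\<close> lies in \<open>(y\<^sub>1\<^sup>2, \<dots>, y\<^sub>d\<^sup>2)\<close>. It is proved by exchanging the rows of
  \<open>A\<close> for those of \<open>B\<close> one at a time; each step is Cramer's rule for a matrix one of whose rows is a
  difference of two rows.
\<close>

section \<open>Ideals generated by the entries of a vector\<close>

abbreviation entry_ideal :: "'a::comm_ring_1 vec \<Rightarrow> 'a set" where
  "entry_ideal v \<equiv> Idl\<^bsub>class_ring\<^esub> (set\<^sub>v v)"

lemma entry_ideal_ideal: "ideal (entry_ideal v) class_ring"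
  by (rule ring.genideal_ideal[OF class_ring.ring_axioms]) simp

lemma entry_ideal_zero: "0 \<in> entry_ideal v"
  using additive_subgroup.zero_closed[OF ideal.axioms(1)[OF entry_ideal_ideal[of v]]] by simp

lemma entry_ideal_add:
  "a \<in> entry_ideal v \<Longrightarrow> b \<in> entry_ideal v \<Longrightarrow> a + b \<in> entry_ideal v"
  using additive_subgroup.a_closed[OF ideal.axioms(1)[OF entry_ideal_ideal[of v]], of a b] by simp

lemma entry_ideal_mult_left: "a \<in> entry_ideal v \<Longrightarrow> b * a \<in> entry_ideal v"
  using ideal.I_l_closed[OF entry_ideal_ideal[of v], of a b] by simp

lemma entry_ideal_uminus: "a \<in> entry_ideal v \<Longrightarrow> - a \<in> entry_ideal v"
  using entry_ideal_mult_left[of a v "- 1"] by simp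

lemma entry_ideal_sum:
  "(\<And>i. i \<in> A \<Longrightarrow> f i \<in> entry_ideal v) \<Longrightarrow> sum f A \<in> entry_ideal v"
  by (induction A rule: infinite_finite_induct) (auto intro: entry_ideal_add entry_ideal_zero)

lemma entry_ideal_gen: "i < dim_vec v \<Longrightarrow> v $ i \<in> entry_ideal v"
  using ring.genideal_self[OF class_ring.ring_axioms, of "set\<^sub>v v"] vec_setI[of v i] by auto

lemma mem_entry_ideal_iff:
  fixes v :: "'a::comm_ring_1 vec"
  shows "a \<in> entry_ideal v \<longleftrightarrow> (\<exists>c. a = (\<Sum>i<dim_vec v. c i * v $ i))"
proof -
  define comb where "comb c = (\<Sum>i<dim_vec v. c i * v $ i)" for c
  have "ideal (range comb) class_ring"
  proof (rule idealI[OF class_ring.ring_axioms])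
    have "group (add_monoid (class_ring :: 'a ring))"
      by (rule abelian_group.a_group[OF ring.is_abelian_group[OF class_ring.ring_axioms]])
    then show "subgroup (range comb) (add_monoid class_ring)"
    proof (rule group.subgroupI)
      fix a assume "a \<in> range comb"
      then obtain c where "a = comb c" by blast
      then have "- a = comb (\<lambda>i. - c i)" by (simp add: comb_def sum_negf)
      moreover have "\<ominus>\<^bsub>class_ring\<^esub> a = - a" by (simp add: class_ring_simps)
      ultimately show "inv\<^bsub>add_monoid class_ring\<^esub> a \<in> range comb"
        unfolding a_inv_def by simp
    next
      fix a b assume "a \<in> range comb" "b \<in> range comb"
      then obtain c e where "a = comb c" "b = comb e" by blast
      then have "a + b = comb (\<lambda>i. c i + e i)"
        by (simp add: comb_def sum.distrib distrib_right)
      then show "a \<otimes>\<^bsub>add_monoid class_ring\<^esub> b \<in> range comb" by simp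
    qed simp_all
    fix a b :: 'a assume "a \<in> range comb"
    then obtain c where "a = comb c" by blast
    then have "b * a = comb (\<lambda>i. b * c i)"
      by (simp add: comb_def sum_distrib_left mult.assoc)
    then show "b \<otimes>\<^bsub>class_ring\<^esub> a \<in> range comb" "a \<otimes>\<^bsub>class_ring\<^esub> b \<in> range comb"
      by (simp_all add: mult.commute)
  qed
  moreover have "set\<^sub>v v \<subseteq> range comb"
  proof
    fix a assume "a \<in> set\<^sub>v v"
    then obtain i where "i < dim_vec v" "v $ i = a" by (rule vec_setE)
    then have "a = comb (\<lambda>j. if j = i then 1 else 0)"
      by (simp add: comb_def if_distrib[of "\<lambda>c. c * _"] cong: if_cong)
    then show "a \<in> range comb" by blast
  qed
  ultimately have "entry_ideal v \<subseteq> range comb"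
    by (rule ring.genideal_minimal[OF class_ring.ring_axioms])
  moreover have "comb c \<in> entry_ideal v" for c
    unfolding comb_def by (auto intro!: entry_ideal_sum entry_ideal_mult_left entry_ideal_gen)
  ultimately show ?thesis unfolding comb_def by blast
qed

lemma mem_entry_ideal_coset_iff:
  "z \<in> entry_ideal v +>\<^bsub>class_ring\<^esub> a \<longleftrightarrow> (\<exists>h\<in>entry_ideal v. z = h + a)"
  by (auto simp: a_r_coset_def')

lemma entry_ideal_coset_eq_iff:
  "entry_ideal v +>\<^bsub>class_ring\<^esub> a = entry_ideal v +>\<^bsub>class_ring\<^esub> b \<longleftrightarrow> a - b \<in> entry_ideal v"
proof
  assume eq: "entry_ideal v +>\<^bsub>class_ring\<^esub> a = entry_ideal v +>\<^bsub>class_ring\<^esub> b"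
  have "a = 0 + a" by simp
  then have "a \<in> entry_ideal v +>\<^bsub>class_ring\<^esub> a"
    unfolding mem_entry_ideal_coset_iff using entry_ideal_zero by blast
  with eq obtain h where "h \<in> entry_ideal v" "a = h + b"
    by (auto simp: mem_entry_ideal_coset_iff)
  then show "a - b \<in> entry_ideal v" by simp
next
  assume ab: "a - b \<in> entry_ideal v"
  have sub: "entry_ideal v +>\<^bsub>class_ring\<^esub> a' \<subseteq> entry_ideal v +>\<^bsub>class_ring\<^esub> b'"
    if "a' - b' \<in> entry_ideal v" for a' b'
  proof
    fix z assume "z \<in> entry_ideal v +>\<^bsub>class_ring\<^esub> a'"
    then obtain h where h: "h \<in> entry_ideal v" "z = h + a'"
      unfolding mem_entry_ideal_coset_iff by blast
    then have "z = (h + (a' - b')) + b'" by simp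
    then show "z \<in> entry_ideal v +>\<^bsub>class_ring\<^esub> b'"
      unfolding mem_entry_ideal_coset_iff using entry_ideal_add[OF h(1) that] by blast
  qed
  show "entry_ideal v +>\<^bsub>class_ring\<^esub> a = entry_ideal v +>\<^bsub>class_ring\<^esub> b"
    using sub[OF ab] sub[of b a] entry_ideal_uminus[OF ab] by auto
qed

lemma entry_ideal_mult_mat_vec:
  assumes "B \<in> carrier_mat m (dim_vec v)" "i < m"
  shows "(B *\<^sub>v v) $ i \<in> entry_ideal v"
  using assms unfolding mem_entry_ideal_iff
  by (intro exI[of _ "\<lambda>j. B $$ (i, j)"]) (simp add: scalar_prod_def atLeast0LessThan)

lemma vec_pow_dim [simp]: "dim_vec (vec_pow x n) = dim_vec x"
  unfolding vec_pow_def by simp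

lemma vec_pow_index [simp]: "i < dim_vec x \<Longrightarrow> vec_pow x n $ i = x $ i ^ n"
  unfolding vec_pow_def by simp

lemma power_entry_mem: "i < dim_vec x \<Longrightarrow> x $ i ^ n \<in> entry_ideal (vec_pow x n)"
  using entry_ideal_gen[of i "vec_pow x n"] by simp

lemma vec_pow_pow: "vec_pow (vec_pow x m) n = vec_pow x (m * n)"
  by (rule eq_vecI) (simp_all add: power_mult)

lemma entry_ideal_power_add:
  assumes "a ^ m \<in> entry_ideal v" "b ^ n \<in> entry_ideal v"
  shows "(a + b) ^ (m + n) \<in> entry_ideal v"
proof -
  have "of_nat (m + n choose k) * a ^ k * b ^ (m + n - k) \<in> entry_ideal v" for k
  proof (cases "m \<le> k")
    case True
    then have "a ^ k = a ^ (k - m) * a ^ m" by (simp flip: power_add)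
    then have "of_nat (m + n choose k) * a ^ k * b ^ (m + n - k)
        = (of_nat (m + n choose k) * a ^ (k - m) * b ^ (m + n - k)) * a ^ m"
      by (simp only: ac_simps)
    then show ?thesis using entry_ideal_mult_left[OF assms(1)] by simp
  next
    case False
    then have "b ^ (m + n - k) = b ^ (m - k) * b ^ n" by (simp flip: power_add)
    then have "of_nat (m + n choose k) * a ^ k * b ^ (m + n - k)
        = (of_nat (m + n choose k) * a ^ k * b ^ (m - k)) * b ^ n"
      by (simp only: ac_simps)
    then show ?thesis using entry_ideal_mult_left[OF assms(2)] by simp
  qed
  then show ?thesis unfolding binomial_ring by (intro entry_ideal_sum)
qed

text \<open>
  The elements with some power in \<open>pow_ideal x k\<close> are closed under addition, by the binomial
  theorem, and contain the multiples of the entries of \<open>x\<close>.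
\<close>

lemma ex_power_mem_pow_ideal:
  fixes x :: "'a::comm_ring_1 vec"
  assumes "a \<in> entry_ideal x"
  shows "\<exists>N. a ^ N \<in> pow_ideal x k"
proof -
  obtain c where c: "a = (\<Sum>i<dim_vec x. c i * x $ i)"
    using assms unfolding mem_entry_ideal_iff by blast
  have "\<exists>N. (\<Sum>i\<in>A. c i * x $ i) ^ N \<in> pow_ideal x k" if "finite A" "A \<subseteq> {..<dim_vec x}" for A
    using that
  proof (induction A rule: finite_induct)
    case empty
    show ?case unfolding pow_ideal_def
      by (rule exI[of _ 1]) (simp add: entry_ideal_zero)
  next
    case (insert i A)
    then obtain N where "(\<Sum>i\<in>A. c i * x $ i) ^ N \<in> pow_ideal x k" by auto
    moreover have "(c i * x $ i) ^ k \<in> pow_ideal x k"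
      using insert.prems power_entry_mem[of i x k] unfolding pow_ideal_def
      by (simp add: power_mult_distrib entry_ideal_mult_left)
    ultimately show ?case using insert.hyps unfolding pow_ideal_def
      by (auto intro: entry_ideal_power_add)
  qed
  from this[of "{..<dim_vec x}"] show ?thesis using c by simp
qed

text \<open>
  The matrices that define the natural map exist as soon as the entries of \<open>y\<close> lie in the radical of
  \<open>(x)\<close>, and the exponent \<open>t\<close> may be taken arbitrarily large. The weaker hypothesis matters: of two
  systems of parameters each lies in the radical of the ideal of the other, so that matrices
  exist in both directions although only \<open>(y) \<subseteq> (x)\<close> is assumed.
\<close>

lemma obtain_power_matrix:
  fixes x y :: "'a::comm_ring_1 vec"
  assumes x: "x \<in> carrier_vec m" and y: "y \<in> carrier_vec d"
    and rad: "\<forall>i<d. \<exists>N. y $ i ^ N \<in> entry_ideal x"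
  obtains t C where "l \<le> t" "0 < t" "C \<in> carrier_mat d m"
    "vec_pow y t = C *\<^sub>v vec_pow x k"
proof -
  have "\<exists>N. y $ i ^ N \<in> pow_ideal x k" if "i < d" for i
    using rad that ex_power_mem_pow_ideal[of _ x k] by (metis power_mult)
  then obtain N where N: "\<And>i. i < d \<Longrightarrow> y $ i ^ N i \<in> pow_ideal x k" by metis
  define t where "t = Suc l + (\<Sum>i<d. N i)"
  have "\<exists>c. y $ i ^ t = (\<Sum>j<m. c j * x $ j ^ k)" if i: "i < d" for i
  proof -
    have "N i \<le> t" unfolding t_def using member_le_sum[of i "{..<d}" N] i by simp
    then have "y $ i ^ t = y $ i ^ (t - N i) * y $ i ^ N i" by (simp flip: power_add)
    then have "y $ i ^ t \<in> pow_ideal x k"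
      using N[OF i] unfolding pow_ideal_def by (simp add: entry_ideal_mult_left)
    then show ?thesis unfolding pow_ideal_def mem_entry_ideal_iff using x by simp
  qed
  then obtain c where c: "\<And>i. i < d \<Longrightarrow> y $ i ^ t = (\<Sum>j<m. c i j * x $ j ^ k)"
    by metis
  show thesis
  proof (rule that)
    show "l \<le> t" "0 < t" unfolding t_def by simp_all
    show "mat (d) (m) (\<lambda>(i, j). c i j) \<in> carrier_mat (d) (m)" by simp
    show "vec_pow y t = mat (d) (m) (\<lambda>(i, j). c i j) *\<^sub>v vec_pow x k"
      by (rule eq_vecI) (use x y in \<open>simp_all add: c scalar_prod_def atLeast0LessThan\<close>)
  qed
qed


section \<open>Determinants of matrices between sequences\<close>

text \<open>
  Cramer's rule: the adjugate of \<open>D\<close> expresses each \<open>det D * x $ i\<close> through the entries of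
  \<open>D *\<^sub>v x\<close>. It makes multiplication by \<open>det D\<close> a map from \<open>R/(x)\<close> to \<open>R/(D x)\<close>.
\<close>

lemma det_mult_entry_in_entry_ideal:
  fixes D :: "'a::comm_ring_1 mat"
  assumes D: "D \<in> carrier_mat d d" and x: "x \<in> carrier_vec d" and a: "a \<in> entry_ideal x"
  shows "det D * a \<in> entry_ideal (D *\<^sub>v x)"
proof -
  have adj: "adj_mat D \<in> carrier_mat d d" using adj_mat(1)[OF D] .
  have "adj_mat D *\<^sub>v (D *\<^sub>v x) = (det D \<cdot>\<^sub>m 1\<^sub>m d) *\<^sub>v x"
    using assoc_mult_mat_vec[OF adj D x] adj_mat(3)[OF D] by simp
  also have "\<dots> = det D \<cdot>\<^sub>v x" using x by (intro eq_vecI) auto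
  finally have eq: "adj_mat D *\<^sub>v (D *\<^sub>v x) = det D \<cdot>\<^sub>v x" .
  have gen: "det D * x $ i \<in> entry_ideal (D *\<^sub>v x)" if "i < d" for i
    using entry_ideal_mult_mat_vec[of "adj_mat D" d "D *\<^sub>v x" i] adj D x that unfolding eq by simp
  obtain c where "a = (\<Sum>i<d. c i * x $ i)" using a x unfolding mem_entry_ideal_iff by auto
  then have "det D * a = (\<Sum>i<d. c i * (det D * x $ i))" by (simp add: sum_distrib_left ac_simps)
  also have "\<dots> \<in> entry_ideal (D *\<^sub>v x)"
    by (rule entry_ideal_sum, rule entry_ideal_mult_left, rule gen) simp
  finally show ?thesis .
qed

text \<open>
  Additivity of the determinant in one row; the cofactors along that row do not see it.
\<close>

lemma det_diff_one_row:
  fixes A B D :: "'a::comm_ring_1 mat"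
  assumes A: "A \<in> carrier_mat d d" and B: "B \<in> carrier_mat d d" and D: "D \<in> carrier_mat d d"
    and k: "k < d"
    and rest: "\<And>i j. i < d \<Longrightarrow> j < d \<Longrightarrow> i \<noteq> k \<Longrightarrow> A $$ (i, j) = D $$ (i, j) \<and> B $$ (i, j) = D $$ (i, j)"
    and row: "\<And>j. j < d \<Longrightarrow> D $$ (k, j) = A $$ (k, j) - B $$ (k, j)"
  shows "det D = det A - det B"
proof -
  have "mat_delete A k j = mat_delete D k j" "mat_delete B k j = mat_delete D k j" if "j < d" for j
    using A B D rest that k unfolding mat_delete_def by (auto intro!: eq_matI)
  then have "cofactor A k j = cofactor D k j" "cofactor B k j = cofactor D k j" if "j < d" for j
    using that unfolding cofactor_def by simp_all
  then show ?thesis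
    unfolding laplace_expansion_row[OF A k] laplace_expansion_row[OF B k] laplace_expansion_row[OF D k]
    by (simp add: row left_diff_distrib sum_subtractf)
qed

text \<open>
  When \<open>A\<close> and \<open>B\<close> differ in row \<open>k\<close> only, the difference of the determinants is the determinant of
  a matrix \<open>D\<close> that maps \<open>x\<close> to \<open>y\<close> with the entry \<open>y\<^sub>k\<close> replaced by 0. By Cramer's rule \<open>det D\<close>
  multiplies \<open>y\<^sub>k \<in> (x)\<close> into the ideal of the other entries of \<open>y\<close>. The product of these other
  entries then turns every \<open>y\<^sub>i\<close> with \<open>i \<noteq> k\<close> into a multiple of \<open>y\<^sub>i\<^sup>2\<close>.
\<close>

lemma prod_mult_det_diff_one_row:
  fixes A B :: "'a::comm_ring_1 mat"
  assumes A: "A \<in> carrier_mat d d" and B: "B \<in> carrier_mat d d" and x: "x \<in> carrier_vec d"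
    and Ax: "A *\<^sub>v x = y" and Bx: "B *\<^sub>v x = y" and k: "k < d"
    and rest: "\<And>i j. i < d \<Longrightarrow> j < d \<Longrightarrow> i \<noteq> k \<Longrightarrow> A $$ (i, j) = B $$ (i, j)"
  shows "(\<Prod>i<d. y $ i) * (det A - det B) \<in> pow_ideal y 2"
proof -
  define D where "D = mat d d (\<lambda>(i, j). if i = k then A $$ (k, j) - B $$ (k, j) else A $$ (i, j))"
  have D: "D \<in> carrier_mat d d" unfolding D_def by simp
  have y: "y \<in> carrier_vec d" using Ax A x by auto
  have detD: "det D = det A - det B"
    by (rule det_diff_one_row[OF A B D k]) (use k rest in \<open>auto simp: D_def\<close>)
  have Ax': "y $ i = (\<Sum>j<d. A $$ (i, j) * x $ j)" if "i < d" for i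
    using Ax A x that by (auto simp: scalar_prod_def atLeast0LessThan)
  have Bx': "y $ i = (\<Sum>j<d. B $$ (i, j) * x $ j)" if "i < d" for i
    using Bx B x that by (auto simp: scalar_prod_def atLeast0LessThan)
  have Dx: "(D *\<^sub>v x) $ i = (if i = k then 0 else y $ i)" if "i < d" for i
  proof -
    have "(D *\<^sub>v x) $ i = (\<Sum>j<d. D $$ (i, j) * x $ j)"
      using D x that by (auto simp: scalar_prod_def atLeast0LessThan)
    also have "\<dots> = (if i = k then (\<Sum>j<d. A $$ (k, j) * x $ j) - (\<Sum>j<d. B $$ (k, j) * x $ j)
        else (\<Sum>j<d. A $$ (i, j) * x $ j))"
      using k that by (simp add: D_def left_diff_distrib sum_subtractf)
    finally show ?thesis using Ax' Bx' that k by auto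
  qed
  have "y $ k \<in> entry_ideal x"
    using entry_ideal_mult_mat_vec[of A d x k] A x k Ax by auto
  then have "det D * y $ k \<in> entry_ideal (D *\<^sub>v x)"
    by (rule det_mult_entry_in_entry_ideal[OF D x])
  then obtain c where "det D * y $ k = (\<Sum>i<d. c i * (D *\<^sub>v x) $ i)"
    unfolding mem_entry_ideal_iff using D by auto
  also have "\<dots> = (\<Sum>i\<in>{..<d} - {k}. c i * y $ i)"
    by (rule sum.mono_neutral_cong_right) (auto simp: Dx split: if_splits)
  finally have yk: "det D * y $ k = (\<Sum>i\<in>{..<d} - {k}. c i * y $ i)" .
  let ?P = "\<Prod>i\<in>{..<d} - {k}. y $ i"
  have "(\<Prod>i<d. y $ i) = y $ k * ?P" using k by (subst prod.remove[of _ k]) auto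
  then have "(\<Prod>i<d. y $ i) * (det A - det B) = ?P * (det D * y $ k)"
    by (simp add: detD ac_simps)
  also have "\<dots> = (\<Sum>i\<in>{..<d} - {k}. c i * (?P * y $ i))"
    unfolding yk by (simp add: sum_distrib_left ac_simps)
  also have "\<dots> \<in> pow_ideal y 2" unfolding pow_ideal_def
  proof (rule entry_ideal_sum, rule entry_ideal_mult_left)
    fix i assume i: "i \<in> {..<d} - {k}"
    then have "?P = y $ i * (\<Prod>j\<in>{..<d} - {k} - {i}. y $ j)" by (subst prod.remove[of _ i]) auto
    then have "?P * y $ i = (\<Prod>j\<in>{..<d} - {k} - {i}. y $ j) * vec_pow y 2 $ i"
      using i y by (simp add: power2_eq_square ac_simps)
    then show "?P * y $ i \<in> entry_ideal (vec_pow y 2)"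
      using i y by (auto intro!: entry_ideal_mult_left power_entry_mem)
  qed
  finally show ?thesis .
qed

text \<open>
  A matrix mapping \<open>x\<close> to \<open>y\<close> is not unique, but the class of \<open>det A / (y\<^sub>1 \<cdots> y\<^sub>d)\<close>
  in the local cohomology is: pass from \<open>A\<close> to \<open>B\<close> by exchanging one row at a time. Each hybrid
  matrix still maps \<open>x\<close> to \<open>y\<close>, since this is a condition on every row separately.
\<close>

lemma prod_mult_det_diff:
  fixes A B :: "'a::comm_ring_1 mat"
  assumes A: "A \<in> carrier_mat d d" and B: "B \<in> carrier_mat d d" and x: "x \<in> carrier_vec d"
    and Ax: "A *\<^sub>v x = y" and Bx: "B *\<^sub>v x = y"
  shows "(\<Prod>i<d. y $ i) * (det A - det B) \<in> pow_ideal y 2"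
proof -
  \<comment> \<open>the first \<open>k\<close> rows are taken from \<open>B\<close>, the others from \<open>A\<close>\<close>
  define H where "H k = mat d d (\<lambda>(i, j). if i < k then B $$ (i, j) else A $$ (i, j))" for k
  have H: "H k \<in> carrier_mat d d" for k unfolding H_def by simp
  have y: "y \<in> carrier_vec d" using Ax A x by auto
  have Hx: "H k *\<^sub>v x = y" for k
  proof (rule eq_vecI)
    fix i assume i: "i < dim_vec y"
    then have id: "i < d" using y by simp
    have "(H k *\<^sub>v x) $ i = (if i < k then (B *\<^sub>v x) $ i else (A *\<^sub>v x) $ i)"
      using id A B x unfolding H_def by (simp add: scalar_prod_def)
    then show "(H k *\<^sub>v x) $ i = y $ i" using Ax Bx by simp
  qed (use y in \<open>simp add: H_def\<close>)
  have "(\<Prod>i<d. y $ i) * (det A - det (H k)) \<in> pow_ideal y 2" if "k \<le> d" for k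
    using that
  proof (induction k)
    case 0
    have "H 0 = A" using A by (auto simp: H_def intro!: eq_matI)
    then show ?case unfolding pow_ideal_def by (simp add: entry_ideal_zero)
  next
    case (Suc k)
    have "(\<Prod>i<d. y $ i) * (det (H k) - det (H (Suc k))) \<in> pow_ideal y 2"
      by (rule prod_mult_det_diff_one_row[OF H H x Hx Hx, of k]) (use Suc.prems in \<open>auto simp: H_def\<close>)
    moreover have "(\<Prod>i<d. y $ i) * (det A - det (H k)) \<in> pow_ideal y 2" using Suc by simp
    ultimately have "(\<Prod>i<d. y $ i) * (det A - det (H k)) + (\<Prod>i<d. y $ i) * (det (H k) - det (H (Suc k)))
        \<in> pow_ideal y 2" unfolding pow_ideal_def by (rule entry_ideal_add[rotated])
    then show ?case by (simp add: algebra_simps)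
  qed
  moreover have "H d = B" using B by (auto simp: H_def intro!: eq_matI)
  ultimately show ?thesis by force
qed


section \<open>Equality of classes in top local cohomology\<close>

text \<open>
  Equality of the fractions \<open>r / (x\<^sub>1\<^sup>n \<cdots> x\<^sub>d\<^sup>n)\<close> and \<open>s / (x\<^sub>1\<^sup>m \<cdots> x\<^sub>d\<^sup>m)\<close> in the direct limit, in
  terms of representatives: some common level \<open>k\<close> identifies their images.
\<close>

definition lc_eq :: "'a::comm_ring_1 vec \<Rightarrow> 'a \<Rightarrow> nat \<Rightarrow> 'a \<Rightarrow> nat \<Rightarrow> bool" where
  "lc_eq x r n s m \<longleftrightarrow> (\<exists>k. n \<le> k \<and> m \<le> k \<and>
     (\<Prod>i<dim_vec x. x $ i) ^ (k - n) * r - (\<Prod>i<dim_vec x. x $ i) ^ (k - m) * s \<in> pow_ideal x k)"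

text \<open>
  The transition maps between the quotients are well defined.
\<close>

lemma prod_power_mult_pow_ideal:
  fixes x :: "'a::comm_ring_1 vec"
  assumes "a \<in> pow_ideal x n" and nm: "n \<le> m"
  shows "(\<Prod>i<dim_vec x. x $ i) ^ (m - n) * a \<in> pow_ideal x m"
proof -
  let ?P = "\<Prod>i<dim_vec x. x $ i"
  from assms(1) obtain c where "a = (\<Sum>i<dim_vec x. c i * x $ i ^ n)"
    unfolding pow_ideal_def mem_entry_ideal_iff by auto
  then have "?P ^ (m - n) * a = (\<Sum>i<dim_vec x. c i * (?P ^ (m - n) * x $ i ^ n))"
    by (simp add: sum_distrib_left ac_simps)
  also have "\<dots> \<in> pow_ideal x m" unfolding pow_ideal_def
  proof (rule entry_ideal_sum, rule entry_ideal_mult_left)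
    fix i assume "i \<in> {..<dim_vec x}"
    then have i: "i < dim_vec x" by simp
    have "?P = x $ i * (\<Prod>j\<in>{..<dim_vec x} - {i}. x $ j)" using i by (subst prod.remove[of _ i]) auto
    moreover have "x $ i ^ (m - n) * x $ i ^ n = x $ i ^ m" using nm by (simp flip: power_add)
    ultimately have "?P ^ (m - n) * x $ i ^ n
        = (\<Prod>j\<in>{..<dim_vec x} - {i}. x $ j) ^ (m - n) * vec_pow x m $ i"
      using i by (simp add: power_mult_distrib ac_simps) (simp flip: mult.assoc)
    then show "?P ^ (m - n) * x $ i ^ n \<in> entry_ideal (vec_pow x m)"
      using i by (auto intro!: entry_ideal_mult_left power_entry_mem)
  qed
  finally show ?thesis .
qed

lemma lc_eq_sym: "lc_eq x r n s m \<Longrightarrow> lc_eq x s m r n"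
  unfolding lc_eq_def pow_ideal_def by (metis entry_ideal_uminus minus_diff_eq)

lemma lc_eq_refl: "lc_eq x r n r n"
  unfolding lc_eq_def pow_ideal_def by (auto simp: entry_ideal_zero)

lemma lc_eq_level_mono:
  fixes x :: "'a::comm_ring_1 vec"
  assumes "(\<Prod>i<dim_vec x. x $ i) ^ (k - n) * r - (\<Prod>i<dim_vec x. x $ i) ^ (k - m) * s \<in> pow_ideal x k"
    and "n \<le> k" "m \<le> k" "k \<le> l"
  shows "(\<Prod>i<dim_vec x. x $ i) ^ (l - n) * r - (\<Prod>i<dim_vec x. x $ i) ^ (l - m) * s \<in> pow_ideal x l"
proof -
  let ?P = "\<Prod>i<dim_vec x. x $ i"
  have "?P ^ (l - n) = ?P ^ (l - k) * ?P ^ (k - n)" "?P ^ (l - m) = ?P ^ (l - k) * ?P ^ (k - m)"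
    using assms(2-4) by (simp_all flip: power_add)
  then have "?P ^ (l - n) * r - ?P ^ (l - m) * s = ?P ^ (l - k) * (?P ^ (k - n) * r - ?P ^ (k - m) * s)"
    by (simp add: right_diff_distrib mult.assoc)
  then show ?thesis using prod_power_mult_pow_ideal[OF assms(1,4)] by simp
qed

lemma lc_eq_trans:
  fixes x :: "'a::comm_ring_1 vec"
  assumes "lc_eq x r n s m" "lc_eq x s m t l"
  shows "lc_eq x r n t l"
proof -
  let ?P = "\<Prod>i<dim_vec x. x $ i"
  obtain j where j: "n \<le> j" "m \<le> j" "?P ^ (j - n) * r - ?P ^ (j - m) * s \<in> pow_ideal x j"
    using assms(1) unfolding lc_eq_def by blast
  obtain k where k: "m \<le> k" "l \<le> k" "?P ^ (k - m) * s - ?P ^ (k - l) * t \<in> pow_ideal x k"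
    using assms(2) unfolding lc_eq_def by blast
  let ?N = "max j k"
  have "?P ^ (?N - n) * r - ?P ^ (?N - m) * s \<in> pow_ideal x ?N"
    by (rule lc_eq_level_mono[OF j(3,1,2)]) simp
  moreover have "?P ^ (?N - m) * s - ?P ^ (?N - l) * t \<in> pow_ideal x ?N"
    by (rule lc_eq_level_mono[OF k(3,1,2)]) simp
  ultimately have "(?P ^ (?N - n) * r - ?P ^ (?N - m) * s) + (?P ^ (?N - m) * s - ?P ^ (?N - l) * t)
      \<in> pow_ideal x ?N"
    unfolding pow_ideal_def by (rule entry_ideal_add)
  then show ?thesis unfolding lc_eq_def using j k by (intro exI[of _ ?N]) auto
qed

lemma carrier_lc_module: "carrier (lc_module x n) = range (\<lambda>r. pow_ideal x n +>\<^bsub>class_ring\<^esub> r)"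
  unfolding lc_module_def quot_module_def
  by (auto simp: ring.defs module.defs FactRing_def A_RCOSETS_def' a_r_coset_def)

lemma lc_trans_coset:
  fixes x :: "'a::comm_ring_1 vec"
  assumes "n \<le> m"
  shows "lc_trans x n m (pow_ideal x n +>\<^bsub>class_ring\<^esub> r) =
    pow_ideal x m +>\<^bsub>class_ring\<^esub> ((\<Prod>i<dim_vec x. x $ i) ^ (m - n) * r)"
proof -
  let ?P = "\<Prod>i<dim_vec x. x $ i"
  have "pow_ideal x m +>\<^bsub>class_ring\<^esub> (?P ^ (m - n) * (h + r)) = pow_ideal x m +>\<^bsub>class_ring\<^esub> (?P ^ (m - n) * r)"
    if "h \<in> pow_ideal x n" for h
    using prod_power_mult_pow_ideal[OF that assms] unfolding pow_ideal_def
    by (subst entry_ideal_coset_eq_iff) (simp add: algebra_simps)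
  moreover have "0 \<in> pow_ideal x n" unfolding pow_ideal_def by (rule entry_ideal_zero)
  ultimately show ?thesis
    unfolding lc_trans_def quot_mult_def a_r_coset_def'[of _ "pow_ideal x n"] by auto
qed

lemma lc_class_conv:
  fixes x :: "'a::comm_ring_1 vec"
  assumes "0 < n"
  shows "lc_class x r n = {(m, pow_ideal x m +>\<^bsub>class_ring\<^esub> s) | m s. 0 < m \<and> lc_eq x r n s m}"
proof -
  have "lc_trans x n k (pow_ideal x n +>\<^bsub>class_ring\<^esub> r) = lc_trans x m k (pow_ideal x m +>\<^bsub>class_ring\<^esub> s)
      \<longleftrightarrow> (\<Prod>i<dim_vec x. x $ i) ^ (k - n) * r - (\<Prod>i<dim_vec x. x $ i) ^ (k - m) * s \<in> pow_ideal x k"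
    if "n \<le> k" "m \<le> k" for m k s
    unfolding lc_trans_coset[OF that(1)] lc_trans_coset[OF that(2)] unfolding pow_ideal_def
    by (rule entry_ideal_coset_eq_iff)
  then have eq: "(\<exists>k\<in>{0<..}. n \<le> k \<and> m \<le> k \<and>
      lc_trans x n k (pow_ideal x n +>\<^bsub>class_ring\<^esub> r) = lc_trans x m k (pow_ideal x m +>\<^bsub>class_ring\<^esub> s))
      \<longleftrightarrow> lc_eq x r n s m" for m s
    unfolding lc_eq_def using greaterThan_iff[of _ "0::nat"] less_le_trans[OF assms] by meson
  show ?thesis
  proof (rule Set.set_eqI)
    fix p :: "nat \<times> 'a set"
    obtain m X where p: "p = (m, X)" by (cases p)
    have "p \<in> lc_class x r n \<longleftrightarrow> 0 < m \<and> X \<in> carrier (lc_module x m) \<and>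
      (\<exists>k\<in>{0<..}. n \<le> k \<and> m \<le> k \<and>
        lc_trans x n k (pow_ideal x n +>\<^bsub>class_ring\<^esub> r) = lc_trans x m k X)"
      unfolding p lc_class_def dirlim_class_def dirlim_rel_def using assms
      by (simp add: carrier_lc_module)
    also have "\<dots> \<longleftrightarrow> (\<exists>s. X = pow_ideal x m +>\<^bsub>class_ring\<^esub> s \<and> 0 < m \<and> lc_eq x r n s m)"
      unfolding carrier_lc_module using eq by blast
    finally show "p \<in> lc_class x r n \<longleftrightarrow>
        p \<in> {(m, pow_ideal x m +>\<^bsub>class_ring\<^esub> s) | m s. 0 < m \<and> lc_eq x r n s m}"
      unfolding p by blast
  qed
qed

lemma lc_class_eq_iff:
  fixes x :: "'a::comm_ring_1 vec"
  assumes "0 < n" "0 < m"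
  shows "lc_class x r n = lc_class x s m \<longleftrightarrow> lc_eq x r n s m"
proof
  assume "lc_class x r n = lc_class x s m"
  moreover have "(m, pow_ideal x m +>\<^bsub>class_ring\<^esub> s) \<in> lc_class x s m"
    unfolding lc_class_conv[OF assms(2)] using assms lc_eq_refl by blast
  ultimately obtain s' where s': "pow_ideal x m +>\<^bsub>class_ring\<^esub> s = pow_ideal x m +>\<^bsub>class_ring\<^esub> s'"
    "lc_eq x r n s' m"
    unfolding lc_class_conv[OF assms(1)] by blast
  have "s' - s \<in> pow_ideal x m"
    using s'(1)[symmetric] unfolding pow_ideal_def entry_ideal_coset_eq_iff .
  then have "lc_eq x s' m s m" unfolding lc_eq_def by (intro exI[of _ m]) simp
  with s'(2) show "lc_eq x r n s m" by (rule lc_eq_trans)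
next
  assume "lc_eq x r n s m"
  then show "lc_class x r n = lc_class x s m"
    unfolding lc_class_conv[OF assms(1)] lc_class_conv[OF assms(2)]
    by (blast intro: lc_eq_trans lc_eq_sym)
qed

lemma carrier_top_local_cohomologyE:
  assumes "u \<in> carrier (top_local_cohomology x)"
  obtains r n where "0 < n" "u = lc_class x r n"
proof -
  from assms obtain n X where "0 < n" "X \<in> carrier (lc_module x n)"
    "u = dirlim_class {0<..} (lc_module x) (lc_trans x) n X"
    unfolding top_local_cohomology_def direct_limit_def dirlim_class_def
    by (auto elim!: quotientE)
  then show thesis using that unfolding lc_class_def carrier_lc_module by blast
qed


section \<open>The determinantal map\<close>

lemma det_mat_diag: "det (mat_diag d f) = (\<Prod>i<d. f i)" for f :: "nat \<Rightarrow> 'a::comm_ring_1"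
proof -
  have "det (mat_diag d f) = prod_list (diag_mat (mat_diag d f))"
    by (rule det_upper_triangular[of _ d]) (auto simp: mat_diag_def)
  also have "\<dots> = (\<Prod>i<d. f i)"
    unfolding prod_list_diag_prod by (auto simp: mat_diag_def atLeast0LessThan intro!: prod.cong)
  finally show ?thesis .
qed

lemma mat_diag_mult_vec:
  fixes v :: "'a::comm_ring_1 vec"
  assumes "v \<in> carrier_vec d"
  shows "mat_diag d f *\<^sub>v v = vec d (\<lambda>i. f i * v $ i)"
proof (rule eq_vecI)
  fix i assume "i < dim_vec (vec d (\<lambda>i. f i * v $ i))"
  then have i: "i < d" by simp
  have "(mat_diag d f *\<^sub>v v) $ i = (\<Sum>j<d. (if i = j then f j else 0) * v $ j)"
    using i assms by (simp add: mat_diag_def scalar_prod_def atLeast0LessThan)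
  also have "\<dots> = f i * v $ i" using i by (simp add: if_distrib[of "\<lambda>c. c * _"] cong: if_cong)
  finally show "(mat_diag d f *\<^sub>v v) $ i = vec d (\<lambda>i. f i * v $ i) $ i" using i by simp
qed (simp add: mat_diag_def)

text \<open>
  The value of the natural map does not change when the fraction \<open>r / (x\<^sub>1\<^sup>n \<cdots> x\<^sub>d\<^sup>n)\<close> is rewritten
  with the denominator of level \<open>k\<close> and the target exponent \<open>s\<close> is raised to \<open>t\<close>. Scaling the rows
  of \<open>B\<close> by the powers \<open>y\<^sub>i\<^sup>t\<^sup>-\<^sup>s\<close>, and the columns of \<open>C\<close> by \<open>x\<^sub>j\<^sup>k\<^sup>-\<^sup>n\<close>, gives two matrices that map
  the \<open>n\<close>-th powers of \<open>x\<close> to the \<open>t\<close>-th powers of \<open>y\<close>, so that \<open>prod_mult_det_diff\<close> compares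
  their determinants.
\<close>

lemma lc_eq_det_refine:
  fixes x y :: "'a::comm_ring_1 vec"
  assumes x: "x \<in> carrier_vec d" and y: "y \<in> carrier_vec d"
    and B: "B \<in> carrier_mat d d" "vec_pow y s = B *\<^sub>v vec_pow x n"
    and C: "C \<in> carrier_mat d d" "vec_pow y t = C *\<^sub>v vec_pow x k"
    and le: "s \<le> t" "n \<le> k"
  shows "lc_eq y (r * det B) s ((\<Prod>i<d. x $ i) ^ (k - n) * r * det C) t"
proof -
  let ?P = "\<Prod>i<d. x $ i" and ?Q = "\<Prod>i<d. y $ i"
  have xc: "vec_pow x m \<in> carrier_vec d" and yc: "vec_pow y m \<in> carrier_vec d" for m
    using x y by (auto intro: carrier_vecI)
  define M where "M = mat_diag d (\<lambda>i. y $ i ^ (t - s)) * B"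
  define M' where "M' = C * mat_diag d (\<lambda>i. x $ i ^ (k - n))"
  have M: "M \<in> carrier_mat d d" and M': "M' \<in> carrier_mat d d"
    unfolding M_def M'_def using mult_carrier_mat[OF mat_diag_dim B(1)] mult_carrier_mat[OF C(1) mat_diag_dim] .
  have "M *\<^sub>v vec_pow x n = mat_diag d (\<lambda>i. y $ i ^ (t - s)) *\<^sub>v vec_pow y s"
    unfolding M_def B(2) using assoc_mult_mat_vec[OF mat_diag_dim B(1) xc] .
  also have "\<dots> = vec_pow y t"
    unfolding mat_diag_mult_vec[OF yc]
    using y le by (intro eq_vecI) (auto simp flip: power_add)
  finally have eq: "M *\<^sub>v vec_pow x n = vec_pow y t" .
  have "M' *\<^sub>v vec_pow x n = C *\<^sub>v (mat_diag d (\<lambda>i. x $ i ^ (k - n)) *\<^sub>v vec_pow x n)"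
    unfolding M'_def using assoc_mult_mat_vec[OF C(1) mat_diag_dim xc] .
  also have "mat_diag d (\<lambda>i. x $ i ^ (k - n)) *\<^sub>v vec_pow x n = vec_pow x k"
    unfolding mat_diag_mult_vec[OF xc]
    using x le by (intro eq_vecI) (auto simp flip: power_add)
  finally have eq': "M' *\<^sub>v vec_pow x n = vec_pow y t" using C(2) by simp
  have "det M = ?Q ^ (t - s) * det B"
    unfolding M_def det_mult[OF mat_diag_dim B(1)] det_mat_diag by (simp add: prod_power_distrib)
  moreover have "det M' = ?P ^ (k - n) * det C"
    unfolding M'_def det_mult[OF C(1) mat_diag_dim] det_mat_diag
    by (simp add: prod_power_distrib mult.commute)
  moreover have "(\<Prod>i<d. vec_pow y t $ i) = ?Q ^ t"
    using y by (simp add: prod_power_distrib)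
  \<comment> \<open>both fractions meet at level \<open>2 t\<close>, the square of the \<open>t\<close>-th powers\<close>
  ultimately have "?Q ^ t * (?Q ^ (t - s) * det B - ?P ^ (k - n) * det C) \<in> pow_ideal y (t * 2)"
    using prod_mult_det_diff[OF M M' xc eq eq'] unfolding pow_ideal_def vec_pow_pow by simp
  then have "r * (?Q ^ t * (?Q ^ (t - s) * det B - ?P ^ (k - n) * det C)) \<in> pow_ideal y (t * 2)"
    unfolding pow_ideal_def by (rule entry_ideal_mult_left)
  moreover have "?Q ^ (t * 2 - s) = ?Q ^ t * ?Q ^ (t - s)" "t * 2 - t = t"
    using le by (simp_all add: mult_2_right flip: power_add)
  ultimately have "?Q ^ (t * 2 - s) * (r * det B) - ?Q ^ (t * 2 - t) * (?P ^ (k - n) * r * det C)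
      \<in> pow_ideal y (t * 2)"
    by (simp add: algebra_simps)
  then show ?thesis unfolding lc_eq_def using le y by (intro exI[of _ "t * 2"]) simp
qed

text \<open>
  Independence of all choices. Both fractions are moved to a level \<open>k\<close> at which their equality is
  visible and to one common matrix \<open>C\<close>; there the claim is that \<open>det C\<close> multiplies
  \<open>pow_ideal x k\<close> into \<open>pow_ideal y t\<close>.
\<close>

lemma lc_eq_det:
  fixes x y :: "'a::comm_ring_1 vec"
  assumes x: "x \<in> carrier_vec d" and y: "y \<in> carrier_vec d"
    and rad: "\<forall>i<d. \<exists>N. y $ i ^ N \<in> entry_ideal x"
    and B: "B \<in> carrier_mat d d" "vec_pow y s = B *\<^sub>v vec_pow x n"
    and B': "B' \<in> carrier_mat d d" "vec_pow y s' = B' *\<^sub>v vec_pow x n'"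
    and eq: "lc_eq x r n r' n'"
  shows "lc_eq y (r * det B) s (r' * det B') s'"
proof -
  let ?P = "\<Prod>i<d. x $ i"
  obtain k where k: "n \<le> k" "n' \<le> k" "?P ^ (k - n) * r - ?P ^ (k - n') * r' \<in> pow_ideal x k"
    using eq x unfolding lc_eq_def by auto
  have xc: "vec_pow x k \<in> carrier_vec d" using x by (auto intro: carrier_vecI)
  obtain t C where t: "s + s' \<le> t" and C: "C \<in> carrier_mat d d" "vec_pow y t = C *\<^sub>v vec_pow x k"
    by (rule obtain_power_matrix[OF x y rad])
  have "det C * (?P ^ (k - n) * r - ?P ^ (k - n') * r') \<in> pow_ideal y t"
    using det_mult_entry_in_entry_ideal[OF C(1), of "vec_pow x k"] k(3) xc
    unfolding pow_ideal_def C(2) by blast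
  then have "lc_eq y (?P ^ (k - n) * r * det C) t (?P ^ (k - n') * r' * det C) t"
    unfolding lc_eq_def by (intro exI[of _ t]) (simp add: algebra_simps)
  moreover have "lc_eq y (r * det B) s (?P ^ (k - n) * r * det C) t"
    using t k by (intro lc_eq_det_refine[OF x y B C]) auto
  moreover have "lc_eq y (r' * det B') s' (?P ^ (k - n') * r' * det C) t"
    using t k by (intro lc_eq_det_refine[OF x y B' C]) auto
  ultimately show ?thesis by (meson lc_eq_trans lc_eq_sym)
qed

lemma lc_map_lc_class:
  fixes x y :: "'a::comm_ring_1 vec"
  assumes x: "x \<in> carrier_vec d" and y: "y \<in> carrier_vec d"
    and rad: "\<forall>i<d. \<exists>N. y $ i ^ N \<in> entry_ideal x"
    and B: "B \<in> carrier_mat d d" "vec_pow y s = B *\<^sub>v vec_pow x n"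
    and pos: "0 < n" "0 < s"
  shows "lc_map x y (lc_class x r n) = lc_class y (r * det B) s"
  unfolding lc_map_def
proof (rule the_equality, goal_cases)
  case 1
  show ?case
    by (rule exI[of _ r], rule exI[of _ n], rule exI[of _ s], rule exI[of _ B]) (use B pos x y in auto)
next
  case (2 v)
  then obtain r' n' s' B' where *: "0 < n'" "0 < s'" "B' \<in> carrier_mat d d"
    "lc_class x r n = lc_class x r' n'" "vec_pow y s' = B' *\<^sub>v vec_pow x n'"
    "v = lc_class y (r' * det B') s'"
    using x y by auto
  have "lc_eq x r' n' r n" using *(4) lc_class_eq_iff *(1) pos(1) by metis
  then have "lc_eq y (r' * det B') s' (r * det B) s"
    by (rule lc_eq_det[OF x y rad *(3,5) B])
  then show ?case using *(2,6) pos(2) lc_class_eq_iff by metis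
qed

text \<open>
  The composite multiplies \<open>r\<close> by \<open>det (C * B)\<close>, where \<open>C * B\<close> is a matrix for the pair
  \<open>(x, x)\<close>. The identity matrix is another one, and independence of the choices, applied with
  \<open>y = x\<close>, shows that both send \<open>u\<close> to the same class.
\<close>

lemma lc_map_lc_map:
  fixes x y :: "'a::comm_ring_1 vec"
  assumes x: "x \<in> carrier_vec d" and y: "y \<in> carrier_vec d"
    and yx: "\<forall>i<d. \<exists>N. y $ i ^ N \<in> entry_ideal x"
    and xy: "\<forall>i<d. \<exists>N. x $ i ^ N \<in> entry_ideal y"
    and u: "u \<in> carrier (top_local_cohomology x)"
  shows "lc_map y x (lc_map x y u) = u"
proof -
  obtain r n where n: "0 < n" and u: "u = lc_class x r n"
    using u by (rule carrier_top_local_cohomologyE)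
  obtain s B where s: "0 < s" and B: "B \<in> carrier_mat d d" "vec_pow y s = B *\<^sub>v vec_pow x n"
    by (rule obtain_power_matrix[OF x y yx])
  obtain t C where t: "0 < t" and C: "C \<in> carrier_mat d d" "vec_pow x t = C *\<^sub>v vec_pow y s"
    by (rule obtain_power_matrix[OF y x xy])
  have xc: "vec_pow x n \<in> carrier_vec d" using x by (auto intro: carrier_vecI)
  have "lc_map y x (lc_map x y u) = lc_class x (r * det B * det C) t"
    unfolding u lc_map_lc_class[OF x y yx B n s] by (rule lc_map_lc_class[OF y x xy C s t])
  also have "r * det B * det C = r * det (C * B)" using det_mult[OF C(1) B(1)] by simp
  also have "lc_class x (r * det (C * B)) t = lc_class x (r * det (1\<^sub>m d)) n"
    unfolding lc_class_eq_iff[OF t n]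
  proof (rule lc_eq_det[OF x x])
    have "x $ i ^ 1 \<in> entry_ideal x" if "i < d" for i
      using entry_ideal_gen[of i x] that x by simp
    then show "\<forall>i<d. \<exists>N. x $ i ^ N \<in> entry_ideal x" by blast
    show "vec_pow x t = (C * B) *\<^sub>v vec_pow x n"
      using assoc_mult_mat_vec[OF C(1) B(1) xc] B(2) C(2) by simp
    show "vec_pow x n = 1\<^sub>m d *\<^sub>v vec_pow x n" using xc by simp
  qed (use B C lc_eq_refl in \<open>auto intro: mult_carrier_mat\<close>)
  finally show ?thesis using u by simp
qed

theorem proposition2p11:
  fixes x y :: "'a::comm_ring_1 vec" and d :: nat
  assumes "noetherian_ring (class_ring :: 'a ring)"
    and "local_ring (class_ring :: 'a ring)"
    and "krull_dim (class_ring :: 'a ring) = enat d"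
    and "x \<in> carrier_vec d"
    and "y \<in> carrier_vec d"
    and "system_of_parameters class_ring x"
    and "Idl\<^bsub>class_ring\<^esub> (set\<^sub>v y) \<subseteq> Idl\<^bsub>class_ring\<^esub> (set\<^sub>v x)"
    and "system_of_parameters class_ring y"
  shows "inj_on (lc_map x y) (carrier (top_local_cohomology x))"
proof (rule inj_on_inverseI[where g = "lc_map y x"])
  fix u assume u: "u \<in> carrier (top_local_cohomology x)"
  have rad: "ideal_radical class_ring (entry_ideal x) = ideal_radical class_ring (entry_ideal y)"
    using assms(6,8) unfolding system_of_parameters_def by simp
  have "y $ i ^ 1 \<in> entry_ideal x" if "i < d" for i
    using assms(5,7) that entry_ideal_gen[of i y] by auto
  then have yx: "\<forall>i<d. \<exists>N. y $ i ^ N \<in> entry_ideal x" by blast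
  have "x $ i ^ 1 \<in> entry_ideal x" if "i < d" for i
    using assms(4) that entry_ideal_gen[of i x] by simp
  then have "x $ i \<in> ideal_radical class_ring (entry_ideal x)" if "i < d" for i
    unfolding ideal_radical_def class_ring_simps using that by blast
  then have xy: "\<forall>i<d. \<exists>N. x $ i ^ N \<in> entry_ideal y"
    unfolding rad unfolding ideal_radical_def class_ring_simps by blast
  show "lc_map y x (lc_map x y u) = u"
    by (rule lc_map_lc_map[OF assms(4,5) yx xy u])
qed

end
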